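(* Let $I=\mathbb{R}$ or $I=[0,\infty)$, let $X$ be a complex Banach space, and let $f:I\to X$ be continuous. (i) If $f$ is almost anti-periodic, then $f$ is almost periodic. (ii) If $f$ is anti-periodic, i.e. there exists $\omega>0$ such that $f(t+\omega)=-f(t)$ for all $t\in I$, then $f$ is almost anti-periodic.
   Context: Let $(X,\|\cdot\|)$ be a complex Banach space and $I=\mathbb{R}$ or $I=[0,\infty)$. A subset $S\subseteq I$ is relatively dense in $I$ if there exists $l>0$ such that every subinterval of $I$ of length $l$ meets $S$. Let $f:I\to X$ be continuous and $\epsilon>0$. A number $\tau\in I\setminus\{0\}$ is an $\epsilon$-period for $f$ if $\|f(t+\tau)-f(t)\|\le\epsilon$ for all $t\in I$, and an $\epsilon$-antiperiod for $f$ if $\|f(t+\tau)+f(t)\|\le\epsilon$ for all $t\in I$. The function $f$ is almost periodic (resp. almost anti-periodic) if for each $\epsilon>0$ the set of all $\epsilon$-periods (resp. $\epsilon$-antiperiods) of $f$ is relatively dense in $I$. *)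

theory Defs
  imports "HOL-Analysis.Analysis"
begin

text \<open>
  The library's class \<^class>\<open>banach\<close> is real.  A complex Banach space is a real one with a
  complex scalar multiplication that extends the real one and for which the norm is
  absolutely homogeneous; the remaining norm axioms and completeness are inherited.
\<close>

class complex_normed_vector = real_normed_vector +
  fixes scaleC :: "complex \<Rightarrow> 'a \<Rightarrow> 'a"  (infixr \<open>*\<^sub>C\<close> 75)
  assumes scaleC_add_right: "a *\<^sub>C (x + y) = a *\<^sub>C x + a *\<^sub>C y"
    and scaleC_add_left: "(a + b) *\<^sub>C x = a *\<^sub>C x + b *\<^sub>C x"
    and scaleC_scaleC: "a *\<^sub>C b *\<^sub>C x = (a * b) *\<^sub>C x"
    and scaleC_one: "1 *\<^sub>C x = x"
    and scaleR_scaleC: "scaleR r x = complex_of_real r *\<^sub>C x"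
    and norm_scaleC: "norm (a *\<^sub>C x) = cmod a * norm x"

class complex_banach = complex_normed_vector + complete_space

subclass (in complex_banach) banach ..

text \<open>
  Below, a function on a subset \<open>I\<close> of the reals is represented by a total function on
  \<^typ>\<open>real\<close> of which only the values on \<open>I\<close> are used; \<open>I\<close> is meant to be closed under
  addition.
\<close>

text \<open>
  Closed subintervals are used; since \<open>l\<close> may be enlarged, open or half-open ones would
  give the same notion.
\<close>

definition relatively_dense_in :: "real set \<Rightarrow> real set \<Rightarrow> bool" where
  "relatively_dense_in I S \<longleftrightarrow>
     S \<subseteq> I \<and> (\<exists>l>0. \<forall>a. {a..a + l} \<subseteq> I \<longrightarrow> {a..a + l} \<inter> S \<noteq> {})"

definition eps_periods :: "real set \<Rightarrow> (real \<Rightarrow> 'a::real_normed_vector) \<Rightarrow> real \<Rightarrow> real set" where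
  "eps_periods I f \<epsilon> = {\<tau> \<in> I - {0}. \<forall>t\<in>I. norm (f (t + \<tau>) - f t) \<le> \<epsilon>}"

definition eps_antiperiods :: "real set \<Rightarrow> (real \<Rightarrow> 'a::real_normed_vector) \<Rightarrow> real \<Rightarrow> real set" where
  "eps_antiperiods I f \<epsilon> = {\<tau> \<in> I - {0}. \<forall>t\<in>I. norm (f (t + \<tau>) + f t) \<le> \<epsilon>}"

definition almost_periodic_on :: "real set \<Rightarrow> (real \<Rightarrow> 'a::real_normed_vector) \<Rightarrow> bool" where
  "almost_periodic_on I f \<longleftrightarrow>
     continuous_on I f \<and> (\<forall>\<epsilon>>0. relatively_dense_in I (eps_periods I f \<epsilon>))"

definition almost_anti_periodic_on :: "real set \<Rightarrow> (real \<Rightarrow> 'a::real_normed_vector) \<Rightarrow> bool" where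
  "almost_anti_periodic_on I f \<longleftrightarrow>
     continuous_on I f \<and> (\<forall>\<epsilon>>0. relatively_dense_in I (eps_antiperiods I f \<epsilon>))"

definition anti_periodic_on :: "real set \<Rightarrow> (real \<Rightarrow> 'a::real_normed_vector) \<Rightarrow> bool" where
  "anti_periodic_on I f \<longleftrightarrow> (\<exists>\<omega>>0. \<forall>t\<in>I. f (t + \<omega>) = - f t)"

end

theory Submission
  imports Defs
begin

text \<open>Shifting by an \<epsilon>/2-antiperiod \<tau> negates \<open>f\<close> up to
  \<epsilon>/2, so shifting by \<tau> twice restores \<open>f\<close> up to \<epsilon>:
  \<open>2 * \<tau>\<close> is an \<epsilon>-period (\<open>double_eps_antiperiod\<close>). Doubling
  a relatively dense set keeps it relatively dense, with \<open>l\<close> replaced by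
  \<open>2 * l\<close>; this gives (i). For (ii), every odd multiple of an exact antiperiod \<omega>
  that lies in \<open>I\<close> is again an exact antiperiod
  (\<open>anti_period_odd_multiple\<close>), and these multiples are spaced
  \<open>2 * \<omega>\<close> apart.\<close>

lemma half_closed_interval_subset:
  fixes I :: "real set"
  assumes "I = UNIV \<or> I = {0..}" "{a..a + 2 * l} \<subseteq> I" "l > 0"
  shows "{a / 2..a / 2 + l} \<subseteq> I"
  using assms by (auto simp: subset_iff dest: spec[of _ a])

lemma double_eps_antiperiod:
  assumes "I = UNIV \<or> I = {0..}" "\<tau> \<in> eps_antiperiods I f (\<epsilon> / 2)"
  shows "2 * \<tau> \<in> eps_periods I f \<epsilon>"
proof -
  have \<tau>: "\<tau> \<in> I" "\<tau> \<noteq> 0" and anti: "\<And>t. t \<in> I \<Longrightarrow> norm (f (t + \<tau>) + f t) \<le> \<epsilon> / 2"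
    using assms(2) by (auto simp: eps_antiperiods_def)
  have "norm (f (t + 2 * \<tau>) - f t) \<le> \<epsilon>" if "t \<in> I" for t
  proof -
    have "t + \<tau> \<in> I"
      using assms(1) \<tau> that by auto
    \<comment> \<open>Insert \<open>f (t + \<tau>)\<close> with both signs; each bracket is an
      antiperiod defect, at \<open>t + \<tau>\<close> and at \<open>t\<close>.\<close>
    have "f (t + 2 * \<tau>) - f t = (f (t + \<tau> + \<tau>) + f (t + \<tau>)) - (f (t + \<tau>) + f t)"
      by (simp add: algebra_simps flip: mult_2)
    also have "norm \<dots> \<le> norm (f (t + \<tau> + \<tau>) + f (t + \<tau>)) + norm (f (t + \<tau>) + f t)"
      by (rule norm_triangle_ineq4)
    also have "\<dots> \<le> \<epsilon> / 2 + \<epsilon> / 2"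
      by (intro add_mono anti \<open>t + \<tau> \<in> I\<close> that)
    finally show ?thesis by simp
  qed
  then show ?thesis
    using assms(1) \<tau> by (auto simp: eps_periods_def)
qed

lemma almost_anti_periodic_imp_almost_periodic:
  assumes I: "I = UNIV \<or> I = {0..}" and "almost_anti_periodic_on I f"
  shows "almost_periodic_on I f"
proof -
  have "relatively_dense_in I (eps_periods I f \<epsilon>)" if "\<epsilon> > 0" for \<epsilon>
  proof -
    have "relatively_dense_in I (eps_antiperiods I f (\<epsilon> / 2))"
      using assms(2) that by (simp add: almost_anti_periodic_on_def)
    then obtain l where "l > 0"
      and l: "\<And>a. {a..a + l} \<subseteq> I \<Longrightarrow> {a..a + l} \<inter> eps_antiperiods I f (\<epsilon> / 2) \<noteq> {}"
      by (auto simp: relatively_dense_in_def)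
    have "{a..a + 2 * l} \<inter> eps_periods I f \<epsilon> \<noteq> {}" if a: "{a..a + 2 * l} \<subseteq> I" for a
    proof -
      \<comment> \<open>Search in the halved interval, so that doubling lands in the given
        one.\<close>
      obtain \<tau> where "\<tau> \<in> {a / 2..a / 2 + l}" "\<tau> \<in> eps_antiperiods I f (\<epsilon> / 2)"
        using l[OF half_closed_interval_subset[OF I a \<open>l > 0\<close>]] by blast
      then have "2 * \<tau> \<in> {a..a + 2 * l} \<inter> eps_periods I f \<epsilon>"
        using double_eps_antiperiod[OF I] by auto
      then show ?thesis by blast
    qed
    moreover have "eps_periods I f \<epsilon> \<subseteq> I"
      by (auto simp: eps_periods_def)
    ultimately show ?thesis
      unfolding relatively_dense_in_def using \<open>l > 0\<close> by (auto intro!: exI[of _ "2 * l"])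
  qed
  then show ?thesis
    using assms(2) by (simp add: almost_anti_periodic_on_def almost_periodic_on_def)
qed

text \<open>Each further pair of shifts by \<omega> flips the sign twice. Only forward shifts occur,
  so closure of \<open>I\<close> under adding \<omega> suffices.\<close>

lemma anti_period_odd_multiple_nat:
  fixes f :: "real \<Rightarrow> 'a::real_normed_vector"
  assumes I: "\<And>t. t \<in> I \<Longrightarrow> t + \<omega> \<in> I"
    and anti: "\<And>t. t \<in> I \<Longrightarrow> f (t + \<omega>) = - f t" and "t \<in> I"
  shows "f (t + (2 * real n + 1) * \<omega>) = - f t"
  using \<open>t \<in> I\<close>
proof (induction n arbitrary: t)
  case (Suc n)
  have "f (t + (2 * real (Suc n) + 1) * \<omega>) = f (t + \<omega> + \<omega> + (2 * real n + 1) * \<omega>)"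
    by (simp add: algebra_simps)
  also have "\<dots> = - f (t + \<omega> + \<omega>)"
    using Suc I by blast
  also have "\<dots> = - f t"
    using anti[OF Suc.prems] anti[OF I[OF Suc.prems]] by simp
  finally show ?case .
qed (use anti in simp)

text \<open>Integer multiples are needed because intervals in the full line may lie to the left of
  0. A backward shift reduces to a forward one started at the shifted point.\<close>

lemma anti_period_odd_multiple:
  fixes f :: "real \<Rightarrow> 'a::real_normed_vector"
  assumes I: "I = UNIV \<or> I = {0..}" and "\<omega> > 0"
    and anti: "\<And>t. t \<in> I \<Longrightarrow> f (t + \<omega>) = - f t"
    and "t \<in> I" "(2 * real_of_int k + 1) * \<omega> \<in> I"
  shows "f (t + (2 * real_of_int k + 1) * \<omega>) = - f t"
proof -
  let ?s = "t + (2 * real_of_int k + 1) * \<omega>"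
  have mem: "s + \<omega> \<in> I" if "s \<in> I" for s
    using I \<open>\<omega> > 0\<close> that by auto
  note odd = anti_period_odd_multiple_nat[of I \<omega> f, OF mem anti]
  show ?thesis
  proof (cases "k \<ge> 0")
    case True
    then show ?thesis
      using odd[of t "nat k"] \<open>t \<in> I\<close> by simp
  next
    case False
    have "?s \<in> I"
      using I assms(4,5) by auto
    \<comment> \<open>For negative \<open>k\<close>, \<open>-(2 * k + 1) = 2 * (- k - 1) + 1\<close>
      is a positive odd number, so a forward shift leads from \<open>?s\<close> back to
      \<open>t\<close>.\<close>
    then have "f (?s + (2 * real (nat (- k - 1)) + 1) * \<omega>) = - f ?s"
      by (intro odd)
    moreover have "?s + (2 * real (nat (- k - 1)) + 1) * \<omega> = t"
      using False by (simp add: algebra_simps)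
    ultimately show ?thesis by simp
  qed
qed

lemma anti_periodic_imp_almost_anti_periodic:
  assumes I: "I = UNIV \<or> I = {0..}" and "continuous_on I f" and "anti_periodic_on I f"
  shows "almost_anti_periodic_on I f"
proof -
  obtain \<omega> where "\<omega> > 0" and anti: "\<And>t. t \<in> I \<Longrightarrow> f (t + \<omega>) = - f t"
    using assms(3) by (auto simp: anti_periodic_on_def)
  have "relatively_dense_in I (eps_antiperiods I f \<epsilon>)" if "\<epsilon> > 0" for \<epsilon>
  proof -
    have "{a..a + 2 * \<omega>} \<inter> eps_antiperiods I f \<epsilon> \<noteq> {}" if a: "{a..a + 2 * \<omega>} \<subseteq> I" for a
    proof -
      \<comment> \<open>The least integer with \<open>a \<le> (2 * k + 1) * \<omega>\<close>;
        rounding up overshoots \<open>a\<close> by at most \<open>2 * \<omega>\<close>.\<close>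
      define k where "k = \<lceil>(a / \<omega> - 1) / 2\<rceil>"
      let ?\<tau> = "(2 * real_of_int k + 1) * \<omega>"
      have "(a / \<omega> - 1) / 2 \<le> real_of_int k" "real_of_int k \<le> (a / \<omega> - 1) / 2 + 1"
        unfolding k_def by linarith+
      then have "a / \<omega> \<le> 2 * real_of_int k + 1" "2 * real_of_int k + 1 \<le> a / \<omega> + 2"
        by (auto simp: field_simps)
      then have bounds: "?\<tau> \<in> {a..a + 2 * \<omega>}"
        using \<open>\<omega> > 0\<close> by (auto simp: field_simps)
      then have "?\<tau> \<in> I"
        using a by blast
      \<comment> \<open>Antiperiods must be nonzero, which parity guarantees here.\<close>
      moreover have "real_of_int (2 * k + 1) \<noteq> 0"
        unfolding of_int_eq_0_iff by presburger
      then have "2 * real_of_int k + 1 \<noteq> 0"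
        by simp
      ultimately have "?\<tau> \<in> eps_antiperiods I f \<epsilon>"
        using anti_period_odd_multiple[of I \<omega> f, OF I \<open>\<omega> > 0\<close> anti] \<open>\<omega> > 0\<close> \<open>\<epsilon> > 0\<close>
        by (simp add: eps_antiperiods_def)
      with bounds show ?thesis by blast
    qed
    moreover have "eps_antiperiods I f \<epsilon> \<subseteq> I"
      by (auto simp: eps_antiperiods_def)
    ultimately show ?thesis
      unfolding relatively_dense_in_def using \<open>\<omega> > 0\<close> by (auto intro!: exI[of _ "2 * \<omega>"])
  qed
  then show ?thesis
    using assms(2) by (simp add: almost_anti_periodic_on_def)
qed

theorem theorem2p2:
  fixes I :: "real set" and f :: "real \<Rightarrow> 'a::complex_banach"
  assumes "I = UNIV \<or> I = {0..}"
    and "continuous_on I f"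
  shows "(almost_anti_periodic_on I f \<longrightarrow> almost_periodic_on I f) \<and>
         (anti_periodic_on I f \<longrightarrow> almost_anti_periodic_on I f)"
  using almost_anti_periodic_imp_almost_periodic anti_periodic_imp_almost_anti_periodic assms
  by blast

end
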